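(* Let $f:\mathbb{R}^d\to\mathbb{R}$ be $L$-smooth convex with $0<L<\infty$, let $g:\mathbb{R}^d\to\mathbb{R}\cup\{\infty\}$ be a closed convex proper function, let $F=f+g$ and $F_\star=\inf_{x\in\mathbb{R}^d}F(x)>-\infty$. Let $N\ge1$, $y_0\in\mathbb{R}^d$, and set $y_{-1}^{\oplus,4}:=y_0$. Define, for $k=0,\dots,N-2$, $$y_{k+1}=y_k^{\oplus,4}+\frac{(N-k+1)(2N-2k-1)}{(N-k+3)(2N-2k+1)}\big(y_k^{\oplus,4}-y_{k-1}^{\oplus,4}\big)+\frac{(4N-4k-1)(2N-2k-1)}{6(N-k+3)(2N-2k+1)}\big(y_k^{\oplus,4}-y_k\big),$$ and $$y_N=y_{N-1}^{\oplus,4}+\frac3{10}\big(y_{N-1}^{\oplus,4}-y_{N-2}^{\oplus,4}\big)+\frac3{40}\big(y_{N-1}^{\oplus,4}-y_{N-1}\big).$$ Then $$\min_{v\in\partial F(y_N^{\oplus,4})}\|v\|^2\le 25L^2\|y_N-y_N^{\oplus,4}\|^2\le\frac{50L}{(N+2)(N+3)}\big(F(y_0)-F_\star\big).$$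
   Context: A function is $L$-smooth convex if it is convex and differentiable with $L$-Lipschitz gradient. For $\alpha>0$ the $\alpha$-proximal gradient step is $y^{\oplus,\alpha}=\operatorname{argmin}_{z\in\mathbb{R}^d}\big(f(y)+\langle\nabla f(y),z-y\rangle+g(z)+\frac{\alpha L}{2}\|z-y\|^2\big)$. $\partial F$ is the convex subdifferential. *)

theory Defs
  imports "HOL-Analysis.Analysis"
begin

definition gradient :: "('a::euclidean_space \<Rightarrow> real) \<Rightarrow> 'a \<Rightarrow> 'a" where
  "gradient f x = (THE D. GDERIV f x :> D)"

definition L_smooth_convex :: "real \<Rightarrow> ('a::euclidean_space \<Rightarrow> real) \<Rightarrow> bool" where
  "L_smooth_convex L f \<longleftrightarrow>
     convex_on UNIV f \<and> (\<forall>x. f differentiable (at x)) \<and> lipschitz_on L UNIV (gradient f)"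

(* The library's epigraph is for real-valued functions; here g may take infinite values,
   but the second component of an epigraph point is always a real number. *)
definition ereal_epigraph :: "('a \<Rightarrow> ereal) \<Rightarrow> ('a \<times> real) set" where
  "ereal_epigraph g = {(x, t). g x \<le> ereal t}"

definition closed_convex_proper :: "('a::euclidean_space \<Rightarrow> ereal) \<Rightarrow> bool" where
  "closed_convex_proper g \<longleftrightarrow>
     closed (ereal_epigraph g) \<and> convex (ereal_epigraph g) \<and>
     (\<forall>x. g x \<noteq> -\<infinity>) \<and> (\<exists>x. g x \<noteq> \<infinity>)"

(* For proper F this set is empty at points where F is infinite. *)
definition subdifferential :: "('a::euclidean_space \<Rightarrow> ereal) \<Rightarrow> 'a \<Rightarrow> 'a set" where
  "subdifferential F x = {v. \<forall>z. F x + ereal (v \<bullet> (z - x)) \<le> F z}"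

(* When f is L-smooth convex, g is closed convex proper and alpha, L > 0, the objective is
   strongly convex, so the minimiser chosen by arg_min exists and is unique. *)
definition prox_grad_step ::
  "('a::euclidean_space \<Rightarrow> real) \<Rightarrow> ('a \<Rightarrow> ereal) \<Rightarrow> real \<Rightarrow> real \<Rightarrow> 'a \<Rightarrow> 'a" where
  "prox_grad_step f g L \<alpha> y =
     arg_min (\<lambda>z. ereal (f y + gradient f y \<bullet> (z - y)) + g z
                    + ereal (\<alpha> * L / 2 * (norm (z - y))\<^sup>2)) (\<lambda>z. True)"

end

theory Submission
  imports Defs
begin

text \<open>
  Write \<open>p\<^sub>k\<close> for the proximal step at \<open>y\<^sub>k\<close> and \<open>d\<^sub>k = y\<^sub>k - p\<^sub>k\<close>. The proximal gradient inequality
  at \<open>y\<^sub>k\<close> reads \<open>F z \<ge> F p\<^sub>k + L (4 d\<^sub>k \<bullet> (z - y\<^sub>k) + 7/2 \<parallel>d\<^sub>k\<parallel>\<^sup>2)\<close>. It is used at \<open>z = p\<^sub>k\<^sub>-\<^sub>1\<close> with weight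
  \<open>1 / ((m + 2) (m + 3))\<close> and at \<open>z = p\<^sub>N\<close> with weight \<open>2 / ((m + 1) (m + 2) (m + 3))\<close>, where
  \<open>m = N - k\<close>; with these weights the function values telescope. What remains is a quadratic form in
  the \<open>d\<^sub>k\<close>. Because the momentum coefficients make \<open>p\<^sub>k - y\<^sub>k\<^sub>+\<^sub>1\<close> a scalar multiple of
  \<open>\<Sum>j\<le>k. d\<^sub>j / ((N-j+1) (N-j+2) (N-j+3))\<close>, its off-diagonal part has rank-one structure, and
  eliminating the variables from \<open>d\<^sub>N\<close> backwards completes a square in each step, which shows
  that the form dominates \<open>\<parallel>d\<^sub>N\<parallel>\<^sup>2 / 2\<close>. Finally \<open>\<nabla>f p\<^sub>N - \<nabla>f y\<^sub>N + 4 L d\<^sub>N\<close> is a subgradient of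
  \<open>F\<close> at \<open>p\<^sub>N\<close> of norm at most \<open>5 L \<parallel>d\<^sub>N\<parallel>\<close>.\<close>

section \<open>Smooth convex functions\<close>

lemma GDERIV_gradient:
  assumes "f differentiable (at x)"
  shows "GDERIV f x :> gradient f x"
proof -
  obtain f' where f': "(f has_derivative f') (at x)"
    using assms by (auto simp: differentiable_def)
  \<comment> \<open>The adjoint of a linear functional, applied to 1, is its Riesz vector.\<close>
  have "f' h = h \<bullet> adjoint f' 1" for h
    using adjoint_works[OF has_derivative_linear[OF f'], of h 1] by simp
  then have "f' = (\<lambda>h. h \<bullet> adjoint f' 1)"
    by auto
  with f' have 1: "GDERIV f x :> adjoint f' 1"
    by (simp add: gderiv_def)
  show ?thesis
    unfolding gradient_def
  proof (rule theI[where P = "\<lambda>D. GDERIV f x :> D", OF 1])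
    fix D assume "GDERIV f x :> D"
    then have "(\<lambda>h. h \<bullet> D) = (\<lambda>h. h \<bullet> adjoint f' 1)"
      using 1 unfolding gderiv_def by (rule has_derivative_unique)
    then show "D = adjoint f' 1"
      by (metis inner_eq_zero_iff inner_diff_right right_minus_eq)
  qed
qed

lemma DERIV_along_line:
  assumes "f differentiable (at (x + t *\<^sub>R h))"
  shows "((\<lambda>s. f (x + s *\<^sub>R h)) has_real_derivative gradient f (x + t *\<^sub>R h) \<bullet> h) (at t)"
proof -
  have "((\<lambda>s. x + s *\<^sub>R h) has_derivative (\<lambda>s. s *\<^sub>R h)) (at t)"
    by (auto intro!: derivative_eq_intros)
  moreover have "(f has_derivative (\<lambda>k. k \<bullet> gradient f (x + t *\<^sub>R h))) (at (x + t *\<^sub>R h))"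
    using GDERIV_gradient[OF assms] by (simp add: gderiv_def)
  ultimately have "((\<lambda>s. f (x + s *\<^sub>R h)) has_derivative
      (\<lambda>s. (s *\<^sub>R h) \<bullet> gradient f (x + t *\<^sub>R h))) (at t)"
    by (rule has_derivative_compose)
  then show ?thesis
    by (simp add: has_field_derivative_def inner_commute mult_commute_abs)
qed

lemma convex_above_tangent:
  assumes f: "L_smooth_convex L f"
  shows "f y + gradient f y \<bullet> (x - y) \<le> f x"
proof -
  define \<phi> where "\<phi> t = f (y + t *\<^sub>R (x - y))" for t
  have conv: "convex_on UNIV f" and diff: "\<And>x. f differentiable (at x)"
    using f by (auto simp: L_smooth_convex_def)
  have "convex_on UNIV \<phi>"
  proof (rule convex_onI)
    fix t a b :: real assume t: "0 < t" "t < 1"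
    have "y + ((1 - t) *\<^sub>R a + t *\<^sub>R b) *\<^sub>R (x - y)
      = (1 - t) *\<^sub>R (y + a *\<^sub>R (x - y)) + t *\<^sub>R (y + b *\<^sub>R (x - y))"
      by (simp add: algebra_simps)
    then show "\<phi> ((1 - t) *\<^sub>R a + t *\<^sub>R b) \<le> (1 - t) * \<phi> a + t * \<phi> b"
      unfolding \<phi>_def using convex_onD[OF conv, of t] t by simp
  qed simp
  moreover have "(\<phi> has_real_derivative gradient f y \<bullet> (x - y)) (at 0)"
    unfolding \<phi>_def using DERIV_along_line[where x = y and t = 0 and h = "x - y", OF diff] by simp
  ultimately have "\<phi> 1 - \<phi> 0 \<ge> (gradient f y \<bullet> (x - y)) * (1 - 0)"
    by (intro convex_on_imp_above_tangent[of UNIV]) auto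
  then show ?thesis
    by (simp add: \<phi>_def)
qed

text \<open>On the segment from \<open>y\<close> to \<open>x\<close>, \<open>f\<close> minus the
  linear and quadratic terms is nonincreasing: Cauchy-Schwarz and the Lipschitz bound make its
  derivative nonpositive.\<close>

lemma descent_lemma:
  assumes f: "L_smooth_convex L f"
  shows "f x \<le> f y + gradient f y \<bullet> (x - y) + L / 2 * (norm (x - y))\<^sup>2"
proof -
  define h where "h = x - y"
  define \<phi> where "\<phi> t = f (y + t *\<^sub>R h) - (t * (gradient f y \<bullet> h) + L / 2 * (norm h)\<^sup>2 * t\<^sup>2)" for t
  have diff: "\<And>x. f differentiable (at x)" and lip: "lipschitz_on L UNIV (gradient f)"
    using f by (auto simp: L_smooth_convex_def)
  have "\<phi> 1 \<le> \<phi> 0"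
  proof (rule DERIV_nonpos_imp_nonincreasing[where f = \<phi> and a = 0 and b = 1])
    fix t :: real assume t: "0 \<le> t" "t \<le> 1"
    let ?D = "gradient f (y + t *\<^sub>R h) \<bullet> h - (gradient f y \<bullet> h + L * (norm h)\<^sup>2 * t)"
    have "(\<phi> has_real_derivative ?D) (at t)"
      unfolding \<phi>_def
      by (rule DERIV_along_line[OF diff] derivative_eq_intros refl | simp)+
    moreover have "(gradient f (y + t *\<^sub>R h) - gradient f y) \<bullet> h
        \<le> norm (gradient f (y + t *\<^sub>R h) - gradient f y) * norm h"
      by (rule norm_cauchy_schwarz)
    moreover have "norm (gradient f (y + t *\<^sub>R h) - gradient f y) \<le> L * (t * norm h)"
      using lipschitz_onD[OF lip, of "y + t *\<^sub>R h" y] t by (simp add: dist_norm)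
    then have "norm (gradient f (y + t *\<^sub>R h) - gradient f y) * norm h \<le> L * (norm h)\<^sup>2 * t"
      by (auto dest: mult_right_mono[of _ _ "norm h"] simp: power2_eq_square algebra_simps)
    ultimately show "\<exists>d. DERIV \<phi> t :> d \<and> d \<le> 0"
      by (intro exI[of _ ?D]) (simp add: inner_diff_left)
  qed simp
  then show ?thesis
    by (simp add: \<phi>_def h_def)
qed

section \<open>The proximal gradient step\<close>

locale composite_problem =
  fixes f :: "'a::euclidean_space \<Rightarrow> real" and g :: "'a \<Rightarrow> ereal" and L \<alpha> c :: real
  assumes L_pos: "0 < L" and alpha: "1 < \<alpha>"
    and smooth: "L_smooth_convex L f"
    and ccp: "closed_convex_proper g"
    and lower_bound: "\<And>x. ereal c \<le> ereal (f x) + g x"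
begin

definition prox_model :: "'a \<Rightarrow> 'a \<Rightarrow> real" where
  "prox_model y z = f y + gradient f y \<bullet> (z - y) + \<alpha> * L / 2 * (norm (z - y))\<^sup>2"

abbreviation step :: "'a \<Rightarrow> 'a" where
  "step y \<equiv> prox_grad_step f g L \<alpha> y"

lemma g_not_MInf [simp]: "g x \<noteq> -\<infinity>"
  using ccp by (auto simp: closed_convex_proper_def)

text \<open>Since \<open>f + g\<close> is bounded below, the descent lemma makes the model coercive, so
  only a compact part of the epigraph of \<open>g\<close> matters.\<close>
lemma ex_prox_minimiser:
  "\<exists>p. \<forall>z. ereal (prox_model y p) + g p \<le> ereal (prox_model y z) + g z"
proof -
  define q where "q = prox_model y"
  \<comment> \<open>The curvature left after the descent lemma has used up
    \<open>L / 2\<close>.\<close>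
  define \<kappa> where "\<kappa> = (\<alpha> - 1) * L / 2"
  have \<kappa>: "\<kappa> > 0" using alpha L_pos by (simp add: \<kappa>_def)
  obtain x0 where x0: "g x0 \<noteq> \<infinity>"
    using ccp by (auto simp: closed_convex_proper_def)
  define c0 where "c0 = q x0 + real_of_ereal (g x0)"
  \<comment> \<open>Trading \<open>g\<close> for the height in its epigraph turns a lower
    semicontinuous problem into minimising a continuous function on a closed set.\<close>
  define C where "C = ereal_epigraph g \<inter> {w. q (fst w) + snd w \<le> c0}"
  define R where "R = sqrt ((c0 - c) / \<kappa>)"
  have cont: "continuous_on UNIV (\<lambda>w::'a \<times> real. q (fst w) + snd w)"
    unfolding q_def prox_model_def by (intro continuous_intros)
  have bound: "norm (z - y) \<le> R \<and> c - f z \<le> t \<and> t \<le> c0 - q z" if "(z, t) \<in> C" for z t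
  proof -
    from that have "g z \<le> ereal t" and le: "q z + t \<le> c0"
      by (auto simp: C_def ereal_epigraph_def)
    then have "ereal c \<le> ereal (f z) + ereal t"
      using lower_bound[of z] by (meson add_left_mono order_trans)
    then have c: "c \<le> f z + t" by simp
    have "f z \<le> q z - \<kappa> * (norm (z - y))\<^sup>2"
      using descent_lemma[OF smooth, of z y]
      by (simp add: q_def prox_model_def \<kappa>_def field_simps)
    with c le have "\<kappa> * (norm (z - y))\<^sup>2 \<le> c0 - c" by linarith
    then have "(norm (z - y))\<^sup>2 \<le> (c0 - c) / \<kappa>"
      using \<kappa> by (simp add: field_simps)
    then have "norm (z - y) \<le> R"
      unfolding R_def by (rule real_le_rsqrt)
    with c le show ?thesis by auto
  qed
  \<comment> \<open>The descent lemma bounds \<open>f z\<close> above on the ball, hence the height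
    from below; the sublevel condition bounds the height from above.\<close>
  define a where "a = c - f y - norm (gradient f y) * R - L / 2 * R\<^sup>2"
  define b where "b = c0 - f y + norm (gradient f y) * R"
  have "C \<subseteq> cball y R \<times> {a..b}"
  proof (clarify, rule conjI)
    fix z t assume "(z, t) \<in> C"
    from bound[OF this] have R: "norm (z - y) \<le> R" and t: "c - f z \<le> t" "t \<le> c0 - q z"
      by auto
    show "z \<in> cball y R"
      using R by (simp add: dist_norm norm_minus_commute)
    have "\<bar>gradient f y \<bullet> (z - y)\<bar> \<le> norm (gradient f y) * norm (z - y)"
      by (rule Cauchy_Schwarz_ineq2)
    also have "\<dots> \<le> norm (gradient f y) * R"
      using R by (simp add: mult_left_mono)
    finally have ip: "\<bar>gradient f y \<bullet> (z - y)\<bar> \<le> norm (gradient f y) * R" .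
    have "L / 2 * (norm (z - y))\<^sup>2 \<le> L / 2 * R\<^sup>2"
      using R L_pos by (intro mult_left_mono power_mono) auto
    with descent_lemma[OF smooth, of z y] ip t(1) have "a \<le> t"
      unfolding a_def by linarith
    moreover have "0 \<le> \<alpha> * L / 2 * (norm (z - y))\<^sup>2"
      using alpha L_pos by simp
    with ip t(2) have "t \<le> b"
      unfolding b_def q_def prox_model_def by linarith
    ultimately show "t \<in> {a..b}" by simp
  qed
  moreover have "closed C"
    unfolding C_def using ccp cont
    by (auto simp: closed_convex_proper_def intro!: closed_Int closed_Collect_le continuous_on_const)
  ultimately have "compact C"
    using bounded_subset[OF bounded_Times[OF bounded_cball bounded_closed_interval]]
    by (auto simp: compact_eq_bounded_closed)
  moreover have "(x0, real_of_ereal (g x0)) \<in> C"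
    using x0 by (auto simp: C_def c0_def ereal_epigraph_def ereal_real)
  ultimately obtain w where w: "w \<in> C" and min: "\<And>w'. w' \<in> C \<Longrightarrow> q (fst w) + snd w \<le> q (fst w') + snd w'"
    using continuous_attains_inf[of C "\<lambda>w. q (fst w) + snd w"] continuous_on_subset[OF cont] by blast
  show ?thesis
  proof (intro exI allI)
    fix z
    have "ereal (q (fst w)) + g (fst w) \<le> ereal (q (fst w)) + ereal (snd w)"
      using w by (intro add_left_mono) (auto simp: C_def ereal_epigraph_def)
    also have "\<dots> \<le> ereal (q z) + g z"
    proof (cases "g z")
      case (real s)
      \<comment> \<open>Outside \<open>C\<close> the objective exceeds \<open>c0\<close>, which
        already bounds the value at \<open>w\<close>.\<close>
      then show ?thesis
        using min[of "(z, s)"] w by (cases "q z + s \<le> c0") (auto simp: C_def ereal_epigraph_def)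
    qed auto
    finally show "ereal (prox_model y (fst w)) + g (fst w) \<le> ereal (prox_model y z) + g z"
      by (simp add: q_def)
  qed
qed

lemma step_minimises:
  "ereal (prox_model y (step y)) + g (step y) \<le> ereal (prox_model y z) + g z"
proof -
  have obj: "ereal (f y + gradient f y \<bullet> (z - y)) + g z + ereal (\<alpha> * L / 2 * (norm (z - y))\<^sup>2)
      = ereal (prox_model y z) + g z" for z
    by (cases "g z") (auto simp: prox_model_def)
  have "\<exists>p. is_arg_min (\<lambda>z. ereal (prox_model y z) + g z) (\<lambda>z. True) p"
    using ex_prox_minimiser[of y] by (auto simp: is_arg_min_def not_less)
  then have "is_arg_min (\<lambda>z. ereal (prox_model y z) + g z) (\<lambda>z. True) (step y)"
    unfolding prox_grad_step_def obj arg_min_def by (rule someI_ex)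
  then show ?thesis
    by (auto simp: is_arg_min_def not_less)
qed

lemma g_step_finite: "g (step y) \<noteq> \<infinity>"
proof -
  obtain x0 where "g x0 \<noteq> \<infinity>"
    using ccp by (auto simp: closed_convex_proper_def)
  then show ?thesis
    using step_minimises[of y x0] by auto
qed

definition g_at :: "'a \<Rightarrow> real" where
  "g_at y = real_of_ereal (g (step y))"

lemma g_step: "g (step y) = ereal (g_at y)"
  using g_step_finite[of y] by (cases "g (step y)") (auto simp: g_at_def)

text \<open>First-order optimality: compare the step \<open>p\<close> with
  \<open>p + t *\<^sub>R h\<close>, bound \<open>g\<close> there by convexity, divide by
  \<open>t\<close> and let \<open>t\<close> tend to 0.\<close>

lemma subgradient_at_step:
  "ereal (g_at y + (\<alpha> * L) *\<^sub>R (y - step y) \<bullet> (z - step y) - gradient f y \<bullet> (z - step y)) \<le> g z"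
proof (cases "g z")
  case (real s)
  define p where "p = step y"
  define h where "h = z - p"
  \<comment> \<open>The slack of the claimed inequality, so the goal is
    \<open>0 \<le> r\<close>.\<close>
  define r where "r = gradient f y \<bullet> h + s - g_at y - (\<alpha> * L) * ((y - p) \<bullet> h)"
  have "0 \<le> r + t * (\<alpha> * L / 2 * (norm h)\<^sup>2)" if t: "0 < t" "t < 1" for t
  proof -
    have "convex (ereal_epigraph g)"
      using ccp by (simp add: closed_convex_proper_def)
    moreover have "(p, g_at y) \<in> ereal_epigraph g" "(z, s) \<in> ereal_epigraph g"
      using real by (simp_all add: ereal_epigraph_def p_def g_step)
    ultimately have "(1 - t) *\<^sub>R (p, g_at y) + t *\<^sub>R (z, s) \<in> ereal_epigraph g"
      using t by (intro convexD_alt) auto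
    moreover have "(1 - t) *\<^sub>R p + t *\<^sub>R z = p + t *\<^sub>R h"
      by (simp add: h_def algebra_simps)
    ultimately have "g (p + t *\<^sub>R h) \<le> ereal ((1 - t) * g_at y + t * s)"
      by (simp add: ereal_epigraph_def)
    with step_minimises[of y "p + t *\<^sub>R h"]
    have "ereal (prox_model y p) + ereal (g_at y)
        \<le> ereal (prox_model y (p + t *\<^sub>R h)) + ereal ((1 - t) * g_at y + t * s)"
      unfolding p_def[symmetric] by (metis add_left_mono g_step order_trans p_def)
    then have le: "prox_model y p + g_at y
        \<le> prox_model y (p + t *\<^sub>R h) + ((1 - t) * g_at y + t * s)"
      by simp
    have nrm: "(norm (p + t *\<^sub>R h - y))\<^sup>2
        = (norm (p - y))\<^sup>2 - 2 * t * ((y - p) \<bullet> h) + t\<^sup>2 * (norm h)\<^sup>2"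
      unfolding power2_norm_eq_inner
      by (simp add: inner_simps inner_commute algebra_simps power2_eq_square)
    have "gradient f y \<bullet> (p + t *\<^sub>R h - y) = gradient f y \<bullet> (p - y) + t * (gradient f y \<bullet> h)"
      by (simp add: inner_simps)
    with le have "0 \<le> t * (r + t * (\<alpha> * L / 2 * (norm h)\<^sup>2))"
      unfolding prox_model_def nrm by (simp add: r_def algebra_simps power2_eq_square)
    then show ?thesis
      using t by (simp add: zero_le_mult_iff)
  qed
  then have "eventually (\<lambda>t. 0 \<le> r + t * (\<alpha> * L / 2 * (norm h)\<^sup>2)) (at_right 0)"
    unfolding eventually_at_right_field by (auto intro!: exI[of _ 1])
  moreover have "((\<lambda>t. r + t * (\<alpha> * L / 2 * (norm h)\<^sup>2)) \<longlongrightarrow> r + 0 * (\<alpha> * L / 2 * (norm h)\<^sup>2)) (at_right 0)"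
    by (intro tendsto_intros)
  ultimately have "0 \<le> r + 0 * (\<alpha> * L / 2 * (norm h)\<^sup>2)"
    by (intro tendsto_lowerbound[of _ _ "at_right 0"]) auto
  then show ?thesis
    using real by (simp add: r_def h_def p_def)
qed simp_all

definition F_at :: "'a \<Rightarrow> real" where
  "F_at y = f (step y) + g_at y"

lemma F_step: "ereal (f (step y)) + g (step y) = ereal (F_at y)"
  by (simp add: F_at_def g_step)

text \<open>Adds the subgradient inequality for \<open>g\<close> at the step, the tangent inequality
  for \<open>f\<close> at \<open>y\<close>, and the descent lemma; the last one costs the
  \<open>1 / 2\<close>.\<close>

lemma prox_grad_inequality:
  "ereal (F_at y + L * (\<alpha> * ((y - step y) \<bullet> (z - y)) + (\<alpha> - 1 / 2) * (norm (y - step y))\<^sup>2))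
    \<le> ereal (f z) + g z"
proof (cases "g z")
  case (real s)
  define p where "p = step y"
  have "g_at y + \<alpha> * L * ((y - p) \<bullet> (z - p)) - gradient f y \<bullet> (z - p) \<le> s"
    using subgradient_at_step[of y z] real by (simp add: p_def)
  moreover have "(y - p) \<bullet> (z - p) = (y - p) \<bullet> (z - y) + (norm (y - p))\<^sup>2"
    unfolding power2_norm_eq_inner by (simp add: inner_diff_right)
  moreover have "gradient f y \<bullet> (z - p) = gradient f y \<bullet> (z - y) - gradient f y \<bullet> (p - y)"
    by (simp add: inner_diff_right)
  moreover have "f y + gradient f y \<bullet> (z - y) \<le> f z"
    by (rule convex_above_tangent[OF smooth])
  moreover have "f p \<le> f y + gradient f y \<bullet> (p - y) + L / 2 * (norm (y - p))\<^sup>2"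
    using descent_lemma[OF smooth, of p y] by (simp only: norm_minus_commute)
  ultimately have "f p + g_at y + \<alpha> * L * ((y - p) \<bullet> (z - y) + (norm (y - p))\<^sup>2)
      - L / 2 * (norm (y - p))\<^sup>2 \<le> f z + s"
    by simp
  also have "f p + g_at y + \<alpha> * L * ((y - p) \<bullet> (z - y) + (norm (y - p))\<^sup>2) - L / 2 * (norm (y - p))\<^sup>2
      = F_at y + L * (\<alpha> * ((y - p) \<bullet> (z - y)) + (\<alpha> - 1 / 2) * (norm (y - p))\<^sup>2)"
    unfolding F_at_def p_def[symmetric]
    by (simp only: distrib_left left_diff_distrib right_diff_distrib) simp
  finally show ?thesis
    using real by (simp add: p_def)
qed auto

text \<open>In the factor \<open>\<alpha> + 1\<close>, the proximal term contributes
  \<open>\<alpha>\<close> and the Lipschitz bound contributes 1.\<close>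

lemma subgradient_F:
  defines "G y \<equiv> gradient f (step y) - gradient f y + (\<alpha> * L) *\<^sub>R (y - step y)"
  shows "G y \<in> subdifferential (\<lambda>x. ereal (f x) + g x) (step y)"
    and "norm (G y) \<le> (\<alpha> + 1) * L * norm (y - step y)"
proof -
  show "G y \<in> subdifferential (\<lambda>x. ereal (f x) + g x) (step y)"
    unfolding subdifferential_def F_step
  proof (intro CollectI allI)
    fix z
    show "ereal (F_at y) + ereal (G y \<bullet> (z - step y)) \<le> ereal (f z) + g z"
    proof (cases "g z")
      case (real s)
      then show ?thesis
        using subgradient_at_step[of y z] convex_above_tangent[OF smooth, of "step y" z]
        by (simp add: F_at_def G_def inner_add_left inner_diff_left)
    qed auto
  qed
  have "norm (gradient f (step y) - gradient f y) \<le> L * norm (y - step y)"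
    using smooth lipschitz_onD[of L UNIV "gradient f" "step y" y]
    by (simp add: L_smooth_convex_def dist_norm norm_minus_commute)
  moreover have "norm ((\<alpha> * L) *\<^sub>R (y - step y)) = \<alpha> * L * norm (y - step y)"
    using alpha L_pos by simp
  ultimately show "norm (G y) \<le> (\<alpha> + 1) * L * norm (y - step y)"
    unfolding G_def by (intro norm_triangle_le) (simp add: algebra_simps)
qed

end

section \<open>Subgradients of minimal norm\<close>

lemma closed_subdifferential:
  assumes "F x = ereal a"
  shows "closed (subdifferential F x)"
proof -
  \<comment> \<open>Each condition cuts out a closed half-space, the whole space or nothing.\<close>
  have "closed {v. F x + ereal (v \<bullet> (z - x)) \<le> F z}" for z
  proof (cases "F z")
    case (real b)
    then show ?thesis
      using assms by (auto intro!: closed_Collect_le continuous_intros)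
  qed (auto simp: assms)
  then have "closed (\<Inter>z. {v. F x + ereal (v \<bullet> (z - x)) \<le> F z})"
    by auto
  also have "(\<Inter>z. {v. F x + ereal (v \<bullet> (z - x)) \<le> F z}) = subdifferential F x"
    by (auto simp: subdifferential_def)
  finally show ?thesis .
qed

lemma closed_ex_min_norm:
  fixes S :: "'a::euclidean_space set"
  assumes "closed S" "S \<noteq> {}"
  shows "\<exists>v. is_arg_min (\<lambda>v. (norm v)\<^sup>2) (\<lambda>v. v \<in> S) v"
proof -
  obtain v where "v \<in> S" "\<And>w. w \<in> S \<Longrightarrow> dist 0 v \<le> dist 0 w"
    using distance_attains_inf[OF assms, of 0] by blast
  then show ?thesis
    by (auto simp: is_arg_min_def not_less intro!: exI[of _ v] power_mono)
qed

section \<open>Coefficients of the potential\<close>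

text \<open>Counted from the end (\<open>m = N - k\<close>), the velocity entering step \<open>k + 1\<close> is
  \<open>vel_coeff m\<close> times a weighted sum of past residuals. The exceptional last step of the method
  is the value 9 at \<open>m = 1\<close>, where the formula would give 5.\<close>
definition vel_coeff :: "nat \<Rightarrow> real" where
  "vel_coeff m = (if m = 1 then 9 else 5 / 6 * (real m + 1) * (real m + 2) * (2 * real m - 1))"

text \<open>\<open>2 / rising3 m\<close> is the difference of \<open>1 / ((m + 1) * (m + 2))\<close>
  and \<open>1 / ((m + 2) * (m + 3))\<close>, which makes the weights telescope.\<close>

definition rising3 :: "nat \<Rightarrow> real" where
  "rising3 m = (real m + 1) * (real m + 2) * (real m + 3)"

definition vel_sum :: "nat \<Rightarrow> real" where
  "vel_sum m = (\<Sum>i\<in>{1..m}. vel_coeff i)"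

text \<open>For \<open>m \<ge> 1\<close> this solves the last identity of
  \<open>step_identities\<close>; the value at 0 comes from the base case of
  \<open>potential_bound\<close>, where \<open>36 / 6 = 8 - 4 / 2\<close>.\<close>

definition cross_coeff :: "nat \<Rightarrow> real" where
  "cross_coeff m = (if m = 0 then 1 / 2 else (rising3 m + 408) / (18 * rising3 m))"

text \<open>The solution of the Riccati recursion obtained by completing the square in every step,
  started at the largest admissible value \<open>1 / 3\<close>.\<close>
definition potential_coeff :: "nat \<Rightarrow> real" where
  "potential_coeff m = 18 / (real m ^ 3 + 48 * real m ^ 2 + 221 * real m + 54)"

lemma rising3_pos: "rising3 m > 0"
  by (simp add: rising3_def add_pos_nonneg)

lemma vel_sum_Suc: "vel_sum (Suc m) = vel_sum m + vel_coeff (Suc m)"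
  by (simp add: vel_sum_def)

text \<open>The trailing 4 is the excess \<open>9 - 5\<close> of the exceptional coefficient at
  1.\<close>

lemma vel_sum_closed_form:
  assumes "m \<ge> 1"
  shows "vel_sum m
    = 5 / 36 * real m * (3 * real m ^ 3 + 16 * real m ^ 2 + 21 * real m - 4) + 4"
  using assms
proof (induction m rule: nat_induct_at_least)
  case base
  then show ?case by (simp add: vel_sum_def vel_coeff_def)
next
  case (Suc n)
  have "vel_coeff (Suc n) = 5 / 6 * (real n + 2) * (real n + 3) * (2 * real n + 1)"
    using Suc.hyps by (simp add: vel_coeff_def algebra_simps)
  then show ?case
    unfolding vel_sum_Suc Suc.IH by (simp add: field_simps power_def)
qed


text \<open>Scalar facts behind the completed square: the first gives its sign, the second its mixed
  coefficient, the third the coefficient of \<open>D \<bullet> D\<close>. The last one matches the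
  terms in \<open>D \<bullet> Zk\<close>.\<close>

lemma step_identities:
  fixes n :: nat
  defines "m \<equiv> Suc n"
  defines "c \<equiv> 1 / (potential_coeff n * (real n + 2) * (real n + 3))"
  shows "potential_coeff m \<le> potential_coeff n"
    and "2 / rising3 m + potential_coeff m * cross_coeff m
      = (potential_coeff n - potential_coeff m) * c"
    and "7 / 2 / ((real n + 2) * (real n + 3)) - 8 / rising3 m - 8 * vel_sum m / (rising3 m)\<^sup>2
        - potential_coeff m * (cross_coeff m)\<^sup>2
      = (potential_coeff n - potential_coeff m) * c\<^sup>2"
    and "10 / 3 * (2 * real m + 1) - 8 * vel_sum m / rising3 m
      = 8 * (1 + vel_sum m / rising3 m) - 4 * cross_coeff m"
proof -
  define x where "x = real n"
  define V where "V = x ^ 3 + 48 * x ^ 2 + 221 * x + 54"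
  \<comment> \<open>This is \<open>V\<close> at \<open>x + 1\<close>, written to expose the factor
    \<open>(x + 3) * (x + 30)\<close> shared with \<open>key\<close>.\<close>
  define W where "W = V + 3 * (x + 3) * (x + 30)"
  define B where "B = (x + 2) * (x + 3) * (x + 4)"
  have x: "x \<ge> 0" by (simp add: x_def)
  have pos: "V > 0" "W > 0" "B > 0" "x + 2 > 0" "x + 3 > 0" "x + 4 > 0"
    using x by (simp_all add: V_def W_def B_def add_nonneg_pos)
  have Wx: "W = x ^ 3 + 51 * x ^ 2 + 320 * x + 324"
    by (simp add: W_def V_def algebra_simps power2_eq_square)
  have pn: "potential_coeff n = 18 / V"
    by (simp add: potential_coeff_def V_def x_def)
  have pm: "potential_coeff m = 18 / W"
    by (simp add: potential_coeff_def Wx m_def x_def algebra_simps power_def)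
  have B: "rising3 m = B"
    by (simp add: rising3_def m_def B_def x_def algebra_simps)
  have g: "cross_coeff m = (B + 408) / (18 * B)"
    by (simp add: cross_coeff_def B) (simp add: m_def)
  have c: "c = V / (18 * (x + 2) * (x + 3))"
    by (simp add: c_def pn x_def)
  have S: "vel_sum m = 5 / 36 * (3 * x ^ 4 + 28 * x ^ 3 + 87 * x ^ 2 + 98 * x + 36) + 4"
    by (subst vel_sum_closed_form) (simp_all add: m_def x_def power_def field_simps)
  have diff: "18 / V - 18 / W = 54 * (x + 3) * (x + 30) / (V * W)"
    using pos by (simp add: field_simps) (simp add: W_def algebra_simps)
  have key: "2 * W + B + 408 = 3 * (x + 3) * (x + 4) * (x + 30)"
    by (simp add: Wx B_def algebra_simps power_def)
  show "potential_coeff m \<le> potential_coeff n"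
    unfolding pn pm using pos x by (simp add: W_def frac_le)
  have vg: "18 / W * ((B + 408) / (18 * B)) = (B + 408) / (B * W)"
    using pos by (simp add: field_simps)
  have "2 / B + (B + 408) / (B * W) = (2 * W + B + 408) / (B * W)"
    using pos by (simp add: field_simps)
  also have "\<dots> = 3 * (x + 30) / ((x + 2) * W)"
    unfolding key unfolding B_def using pos by (simp add: divide_simps) (simp add: algebra_simps)
  also have "\<dots> = 54 * (x + 3) * (x + 30) / (V * W) * (V / (18 * (x + 2) * (x + 3)))"
    using pos by (simp add: divide_simps) (simp add: algebra_simps)
  finally have second: "2 / B + (B + 408) / (B * W)
      = 54 * (x + 3) * (x + 30) / (V * W) * (V / (18 * (x + 2) * (x + 3)))" .
  then show "2 / rising3 m + potential_coeff m * cross_coeff m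
      = (potential_coeff n - potential_coeff m) * c"
    unfolding pn pm B g c vg diff .
  have c': "c = (x + 4) * V / (18 * B)"
    unfolding c B_def using pos by (simp add: divide_simps)
  have "cross_coeff m + c = (B + 408 + (x + 4) * V) / (18 * B)"
    unfolding g c' by (simp add: add_divide_distrib)
  also have "B + 408 + (x + 4) * V = (x + 2) * W"
    by (simp add: Wx V_def B_def algebra_simps power_def)
  finally have gc: "cross_coeff m + c = (x + 2) * W / (18 * B)" .
  \<comment> \<open>The second identity replaces one factor \<open>c\<close>; then \<open>gc\<close>
    cancels \<open>W\<close>.\<close>
  have "potential_coeff m * (cross_coeff m)\<^sup>2 + (potential_coeff n - potential_coeff m) * c\<^sup>2
      = potential_coeff m * (cross_coeff m)\<^sup>2 + (2 / B + potential_coeff m * cross_coeff m) * c"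
    using second unfolding pn pm g c vg diff by (simp add: power2_eq_square mult.assoc)
  also have "\<dots> = potential_coeff m * cross_coeff m * (cross_coeff m + c) + 2 / B * c"
    by (simp add: algebra_simps power2_eq_square)
  also have "\<dots> = ((B + 408) * (x + 2) + 2 * (x + 4) * V) / (18 * B\<^sup>2)"
    unfolding gc unfolding pm g vg c' using pos by (simp add: field_simps power2_eq_square)
  also have "(B + 408) * (x + 2) + 2 * (x + 4) * V
      = 63 * (x + 4) * B - 144 * B - 144 * vel_sum m"
    unfolding S by (simp add: V_def B_def algebra_simps power_def)
  also have "\<dots> / (18 * B\<^sup>2) = 7 / 2 * ((x + 4) / B) - 8 / B - 8 * vel_sum m / B\<^sup>2"
    using pos by (simp add: field_simps power2_eq_square)
  also have "(x + 4) / B = 1 / ((x + 2) * (x + 3))"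
    using pos by (simp add: B_def)
  finally show "7 / 2 / ((real n + 2) * (real n + 3)) - 8 / rising3 m - 8 * vel_sum m / (rising3 m)\<^sup>2
        - potential_coeff m * (cross_coeff m)\<^sup>2
      = (potential_coeff n - potential_coeff m) * c\<^sup>2"
    unfolding B x_def[symmetric] by simp
  show "10 / 3 * (2 * real m + 1) - 8 * vel_sum m / rising3 m
      = 8 * (1 + vel_sum m / rising3 m) - 4 * cross_coeff m"
    unfolding B g S using pos
    by (simp add: field_simps m_def x_def[symmetric]) (simp add: B_def algebra_simps power_def)
qed

section \<open>The potential argument\<close>

text \<open>Here \<open>q k\<close> stands for the paper's \<open>y\<^sub>k\<^sub>-\<^sub>1\<close> after its proximal step, so that
  \<open>q 0\<close> is the starting point.\<close>
locale super_fista_sequence =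
  fixes N :: nat and y q :: "nat \<Rightarrow> 'a::real_inner"
  assumes start: "q 0 = y 0"
    and momentum: "\<And>k. k + 2 \<le> N \<Longrightarrow>
      y (k + 1) = q (k + 1)
        + (((real N - real k + 1) * (2 * real N - 2 * real k - 1))
            / ((real N - real k + 3) * (2 * real N - 2 * real k + 1))) *\<^sub>R (q (k + 1) - q k)
        + (((4 * real N - 4 * real k - 1) * (2 * real N - 2 * real k - 1))
            / (6 * (real N - real k + 3) * (2 * real N - 2 * real k + 1))) *\<^sub>R (q (k + 1) - y k)"
    and last_momentum: "y N = q N + (3 / 10) *\<^sub>R (q N - q (N - 1)) + (3 / 40) *\<^sub>R (q N - y (N - 1))"
begin

section \<open>Unrolling the momentum recursion\<close>

definition d :: "nat \<Rightarrow> 'a" where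
  "d k = y k - q (k + 1)"

definition Z :: "nat \<Rightarrow> 'a" where
  "Z k = (\<Sum>j<k. (1 / rising3 (N - j)) *\<^sub>R d j)"

text \<open>The part of \<open>q (N - m) - q (N + 1)\<close> due to residuals from index
  \<open>N - m\<close> on; earlier ones enter through \<open>Z\<close>.\<close>

definition tail :: "nat \<Rightarrow> 'a" where
  "tail m = (\<Sum>i\<le>m. (1 + vel_sum i / rising3 i) *\<^sub>R d (N - i))"

text \<open>Serves twice: the potential carries its square, and together with \<open>tail\<close> it
  forms the vector paired with \<open>Z\<close>.\<close>

definition cross :: "nat \<Rightarrow> 'a" where
  "cross m = (\<Sum>i\<le>m. cross_coeff i *\<^sub>R d (N - i))"

text \<open>The relation for \<open>b\<close> rescales the old velocity; the one for
  \<open>b + e\<close> gives the new residual its weight in \<open>Z\<close>.\<close>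

lemma momentum_vel_coeff:
  assumes "k < N"
  shows "\<exists>b e. y (k + 1) = q (k + 1) + b *\<^sub>R (q (k + 1) - q k) + e *\<^sub>R (q (k + 1) - y k)
    \<and> (0 < k \<longrightarrow> vel_coeff (N - k) = b * vel_coeff (N - k + 1)) \<and> b + e = vel_coeff (N - k) / rising3 (N - k)"
proof (cases "k + 2 \<le> N")
  case True
  define x where "x = real (N - k)"
  have x: "real N = x + real k" and x2: "x \<ge> 2"
    using True by (auto simp: x_def)
  have v: "vel_coeff (N - k) = 5 / 6 * (x + 1) * (x + 2) * (2 * x - 1)"
    "vel_coeff (N - k + 1) = 5 / 6 * (x + 2) * (x + 3) * (2 * x + 1)"
    using True by (auto simp: vel_coeff_def x_def[symmetric] field_simps)
  have r: "rising3 (N - k) = (x + 1) * (x + 2) * (x + 3)"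
    by (simp add: rising3_def x_def)
  have pos: "x + 1 > 0" "x + 2 > 0" "x + 3 > 0" "2 * x + 1 > 0"
    using x2 by auto
  define b where "b = (x + 1) * (2 * x - 1) / ((x + 3) * (2 * x + 1))"
  define e where "e = (4 * x - 1) * (2 * x - 1) / (6 * (x + 3) * (2 * x + 1))"
  have 1: "y (k + 1) = q (k + 1) + b *\<^sub>R (q (k + 1) - q k) + e *\<^sub>R (q (k + 1) - y k)"
    using momentum[OF True] unfolding x b_def e_def by (simp add: algebra_simps)
  have 2: "vel_coeff (N - k) = b * vel_coeff (N - k + 1)"
    unfolding v b_def using pos by (simp add: divide_simps) (simp add: algebra_simps)
  have "b + e = (2 * x - 1) * (5 * (2 * x + 1)) / (6 * (x + 3) * (2 * x + 1))"
    unfolding b_def e_def using pos by (simp add: divide_simps) (simp add: algebra_simps)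
  also have "\<dots> = vel_coeff (N - k) / rising3 (N - k)"
    unfolding v r using pos by (simp add: divide_simps) (simp add: algebra_simps)
  finally show ?thesis
    using 1 2 by blast
next
  case False
  \<comment> \<open>Since \<open>vel_coeff 2 = 30\<close> and \<open>rising3 1 = 24\<close>, the
    exceptional step obeys the same relations: \<open>9 = 3 / 10 * 30\<close> and
    \<open>3 / 10 + 3 / 40 = 9 / 24\<close>.\<close>
  with assms have k: "k = N - 1" "N - k = 1" "k + 1 = N" by auto
  show ?thesis
    using last_momentum k
    by (intro exI[of _ "3 / 10"] exI[of _ "3 / 40"]) (auto simp: vel_coeff_def rising3_def)
qed

text \<open>One iteration maps \<open>q k - y k\<close> to \<open>b\<close> times itself plus
  \<open>b + e\<close> times \<open>d k\<close>, so it stays a multiple of \<open>Z\<close>; both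
  sides start at 0.\<close>

lemma velocity:
  assumes "k \<le> N"
  shows "q k - y k = vel_coeff (N - k + 1) *\<^sub>R Z k"
  using assms
proof (induction k)
  case 0
  then show ?case by (simp add: start Z_def)
next
  case (Suc k)
  obtain b e where y: "y (k + 1) = q (k + 1) + b *\<^sub>R (q (k + 1) - q k) + e *\<^sub>R (q (k + 1) - y k)"
    and b: "0 < k \<longrightarrow> vel_coeff (N - k) = b * vel_coeff (N - k + 1)"
    and e: "b + e = vel_coeff (N - k) / rising3 (N - k)"
    using momentum_vel_coeff[of k] Suc.prems by auto
  have "q (k + 1) - y (k + 1) = b *\<^sub>R (q k - y k) + (b + e) *\<^sub>R d k"
    unfolding y by (simp add: d_def algebra_simps)
  also have "b *\<^sub>R (q k - y k) = vel_coeff (N - k) *\<^sub>R Z k"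
    using Suc b by (cases "k = 0") (simp_all add: start Z_def)
  finally show ?case
    using Suc.prems e by (simp add: Z_def algebra_simps Suc_diff_Suc)
qed

text \<open>Telescopes \<open>q k - q (k + 1) = (q k - y k) + d k\<close> backwards from
  \<open>N\<close>; each \<open>Z (k + 1)\<close> splits off \<open>d k\<close>, so a single
  \<open>Z\<close> remains.\<close>

lemma displacement:
  assumes "m \<le> N"
  shows "q (N - m) - q (N + 1) = vel_sum (m + 1) *\<^sub>R Z (N - m) + tail m"
  using assms
proof (induction m)
  case 0
  have "q N - q (N + 1) = (q N - y N) + d N"
    by (simp add: d_def)
  then show ?case
    using velocity[of N] by (simp add: tail_def vel_sum_def)
next
  case (Suc m)
  define k where "k = N - Suc m"
  have k: "N - m = Suc k" "N - k = Suc m" and kN: "k < N"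
    using Suc.prems by (auto simp: k_def)
  have Zs: "Z (Suc k) = Z k + (1 / rising3 (Suc m)) *\<^sub>R d k"
    by (simp add: Z_def k)
  have "q k - q (N + 1) = (q k - y k) + d k + (q (Suc k) - q (N + 1))"
    by (simp add: d_def)
  also have "\<dots> = vel_coeff (Suc (Suc m)) *\<^sub>R Z k + d k + (vel_sum (Suc m) *\<^sub>R Z (Suc k) + tail m)"
    using Suc velocity[of k] kN by (simp add: k)
  also have "\<dots> = vel_sum (Suc (Suc m)) *\<^sub>R Z k + (tail m + (1 + vel_sum (Suc m) / rising3 (Suc m)) *\<^sub>R d k)"
    unfolding Zs vel_sum_Suc[of "Suc m"] by (simp add: algebra_simps)
  finally show ?case
    by (simp add: tail_def k_def)
qed

text \<open>The two sides differ exactly by a nonnegative multiple of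
  \<open>(norm (P - c *\<^sub>R D))\<^sup>2\<close>.\<close>
lemma potential_step:
  fixes D Zk P E :: 'a and n :: nat
  defines "m \<equiv> Suc n"
  shows "potential_coeff m * (norm (P + cross_coeff m *\<^sub>R D))\<^sup>2
      + Zk \<bullet> (8 *\<^sub>R (E + (1 + vel_sum m / rising3 m) *\<^sub>R D) - 4 *\<^sub>R (P + cross_coeff m *\<^sub>R D))
    \<le> 10 / 3 * (2 * real m + 1) * (D \<bullet> Zk) + 7 / 2 / ((real n + 3) * (real n + 4)) * (norm D)\<^sup>2
      + (potential_coeff n * (norm P)\<^sup>2
          + (Zk + (1 / rising3 m) *\<^sub>R D) \<bullet> (8 *\<^sub>R E - 4 *\<^sub>R P))
      + 2 / rising3 m * (7 / 2 * (norm D)\<^sup>2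
          - 4 * (D \<bullet> (D + vel_sum m *\<^sub>R (Zk + (1 / rising3 m) *\<^sub>R D) + E)))"
proof -
  define B where "B = rising3 m"
  define S where "S = vel_sum m"
  define g where "g = cross_coeff m"
  define v where "v = potential_coeff m"
  define v' where "v' = potential_coeff n"
  define c where "c = 1 / (v' * (real n + 2) * (real n + 3))"
  note ids = step_identities[of n, folded m_def, folded B_def S_def g_def v_def v'_def, folded c_def]
  have B: "B = (real n + 2) * (real n + 3) * (real n + 4)"
    by (simp add: B_def rising3_def m_def algebra_simps)
  \<comment> \<open>The inequality at the last point adds \<open>7 / B\<close>, which restores the
    weight of the previous index.\<close>
  have lam: "7 / 2 / ((real n + 3) * (real n + 4)) + 7 / B = 7 / 2 / ((real n + 2) * (real n + 3))"
    unfolding B by (simp add: divide_simps add_nonneg_eq_0_iff) (simp add: algebra_simps)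
  have "0 \<le> (v' - v) * (norm (P - c *\<^sub>R D))\<^sup>2"
    using ids(1) by simp
  also have "\<dots> = (v' - v) * (P \<bullet> P) - 2 * ((v' - v) * c) * (D \<bullet> P) + (v' - v) * c\<^sup>2 * (D \<bullet> D)"
    unfolding power2_norm_eq_inner
    by (simp add: inner_simps inner_commute algebra_simps power2_eq_square)
  finally have sq: "0 \<le> (v' - v) * (P \<bullet> P) - 2 * (2 / B + v * g) * (D \<bullet> P)
      + (7 / 2 / ((real n + 3) * (real n + 4)) + 7 / B - 8 / B - 8 * S / B\<^sup>2 - v * g\<^sup>2) * (D \<bullet> D)"
    unfolding ids(2)[symmetric] ids(3)[symmetric] lam .
  have DZ: "10 / 3 * (2 * real m + 1) * (D \<bullet> Zk) = (8 * (1 + S / B) - 4 * g + 8 * S / B) * (D \<bullet> Zk)"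
    using ids(4) by simp
  show ?thesis
    unfolding B_def[symmetric] S_def[symmetric] g_def[symmetric] v_def[symmetric] v'_def[symmetric] DZ
    using sq unfolding power2_norm_eq_inner
    by (simp add: inner_simps inner_commute algebra_simps power2_eq_square)
qed

text \<open>\<open>\<psi>\<close> stands for function values divided by \<open>L\<close>. Each
  induction step adds the two inequalities for one earlier residual; at \<open>m = N\<close> the
  vector \<open>Z 0\<close> is 0 and the bound on \<open>d N\<close> remains.\<close>

lemma potential_bound:
  fixes \<psi> :: "nat \<Rightarrow> real"
  assumes consec: "\<And>k. k \<le> N \<Longrightarrow>
      4 * (d k \<bullet> (q k - y k)) + 7 / 2 * (norm (d k))\<^sup>2 \<le> \<psi> k - \<psi> (k + 1)"
    and to_last: "\<And>k. k < N \<Longrightarrow>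
      4 * (d k \<bullet> (q (N + 1) - y k)) + 7 / 2 * (norm (d k))\<^sup>2 \<le> \<psi> (N + 1) - \<psi> (k + 1)"
    and "m \<le> N"
  shows "(norm (d N))\<^sup>2 / 2 + potential_coeff m * (norm (cross m))\<^sup>2
      + Z (N - m) \<bullet> (8 *\<^sub>R tail m - 4 *\<^sub>R cross m)
    \<le> (\<psi> (N - m) - \<psi> (N + 1)) / ((real m + 2) * (real m + 3))"
  using \<open>m \<le> N\<close>
proof (induction m)
  case 0
  \<comment> \<open>The value \<open>1 / 3\<close> makes the base case tight:
    \<open>1 / 2 + 1 / 3 * 1 / 4 = 7 / 12\<close>, which is \<open>7 / 2\<close> divided by
    6.\<close>
  have base: "potential_coeff 0 = 1 / 3" "cross 0 = (1 / 2) *\<^sub>R d N" "tail 0 = d N"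
    by (simp_all add: potential_coeff_def cross_def cross_coeff_def tail_def vel_sum_def)
  have "q N - y N = 9 *\<^sub>R Z N"
    using velocity[of N] by (simp add: vel_coeff_def)
  then have "36 * (d N \<bullet> Z N) + 7 / 2 * (d N \<bullet> d N) \<le> \<psi> N - \<psi> (N + 1)"
    using consec[of N] by (simp add: power2_norm_eq_inner)
  then show ?case
    unfolding base diff_zero power2_norm_eq_inner
    by (simp add: inner_simps inner_commute)
next
  case (Suc n)
  define m where "m = Suc n"
  define k where "k = N - m"
  define B where "B = rising3 m"
  define l where "l = 1 / ((real m + 2) * (real m + 3))"
  have k: "N - n = Suc k" "N - k = m" and kN: "k < N"
    using Suc.prems by (auto simp: k_def m_def)
  have Bpos: "B > 0" by (simp add: B_def rising3_pos)
  have lpos: "l > 0" by (simp add: l_def)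
  have Zs: "Z (Suc k) = Z k + (1 / B) *\<^sub>R d k"
    by (simp add: Z_def k B_def)
  \<comment> \<open>Because of this identity \<open>\<psi> (k + 1)\<close> cancels when facts 1, 2
    and 3 are added.\<close>
  have lB: "1 / ((real n + 2) * (real n + 3)) = l + 2 / B"
    unfolding l_def B_def rising3_def m_def by (simp add: divide_simps add_nonneg_eq_0_iff) (simp add: algebra_simps)
  have ln: "7 / 2 * l = 7 / 2 / ((real n + 3) * (real n + 4))"
    by (simp add: l_def m_def add.commute)
  have tail_m: "tail m = tail n + (1 + vel_sum m / rising3 m) *\<^sub>R d k"
    and cross_m: "cross m = cross n + cross_coeff m *\<^sub>R d k"
    by (simp_all add: tail_def cross_def m_def k_def)
  have vel: "4 * l * vel_coeff (m + 1) = 10 / 3 * (2 * real m + 1)"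
    unfolding l_def vel_coeff_def m_def by (simp add: divide_simps add_nonneg_eq_0_iff) (simp add: algebra_simps)
  have "l * (4 * (d k \<bullet> (q k - y k)) + 7 / 2 * (norm (d k))\<^sup>2) \<le> l * (\<psi> k - \<psi> (k + 1))"
    using lpos consec[of k] kN by (intro mult_left_mono) auto
  then have 1: "10 / 3 * (2 * real m + 1) * (d k \<bullet> Z k) + 7 / 2 * l * (norm (d k))\<^sup>2 \<le> l * (\<psi> k - \<psi> (k + 1))"
    using velocity[of k] kN unfolding vel[symmetric] k by (simp add: algebra_simps)
  have "q (Suc k) - q (N + 1) = vel_sum m *\<^sub>R Z (Suc k) + tail n"
    using displacement[of n] Suc.prems by (simp add: k m_def)
  then have "q (N + 1) - y k = - (d k + vel_sum m *\<^sub>R (Z k + (1 / B) *\<^sub>R d k) + tail n)"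
    unfolding Zs[symmetric] by (simp add: d_def algebra_simps)
  from to_last[OF kN, unfolded this inner_minus_right]
  have "7 / 2 * (norm (d k))\<^sup>2
      - 4 * (d k \<bullet> (d k + vel_sum m *\<^sub>R (Z k + (1 / B) *\<^sub>R d k) + tail n)) \<le> \<psi> (N + 1) - \<psi> (k + 1)"
    by linarith
  then have 2: "2 / B * (7 / 2 * (norm (d k))\<^sup>2
      - 4 * (d k \<bullet> (d k + vel_sum m *\<^sub>R (Z k + (1 / B) *\<^sub>R d k) + tail n)))
      \<le> 2 / B * (\<psi> (N + 1) - \<psi> (k + 1))"
    using Bpos by (intro mult_left_mono) auto
  have 3: "(norm (d N))\<^sup>2 / 2 + potential_coeff n * (norm (cross n))\<^sup>2
      + (Z k + (1 / B) *\<^sub>R d k) \<bullet> (8 *\<^sub>R tail n - 4 *\<^sub>R cross n)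
      \<le> (l + 2 / B) * (\<psi> (k + 1) - \<psi> (N + 1))"
    using Suc.IH Suc.prems unfolding k Zs lB[symmetric] by simp
  have 4: "potential_coeff m * (norm (cross m))\<^sup>2 + Z k \<bullet> (8 *\<^sub>R tail m - 4 *\<^sub>R cross m)
    \<le> 10 / 3 * (2 * real m + 1) * (d k \<bullet> Z k) + 7 / 2 * l * (norm (d k))\<^sup>2
      + (potential_coeff n * (norm (cross n))\<^sup>2
          + (Z k + (1 / B) *\<^sub>R d k) \<bullet> (8 *\<^sub>R tail n - 4 *\<^sub>R cross n))
      + 2 / B * (7 / 2 * (norm (d k))\<^sup>2
          - 4 * (d k \<bullet> (d k + vel_sum m *\<^sub>R (Z k + (1 / B) *\<^sub>R d k) + tail n)))"
    unfolding tail_m cross_m B_def ln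
    using potential_step[of n "cross n" "d k" "Z k" "tail n", folded m_def] .
  have "(norm (d N))\<^sup>2 / 2 + potential_coeff m * (norm (cross m))\<^sup>2
      + Z k \<bullet> (8 *\<^sub>R tail m - 4 *\<^sub>R cross m)
    \<le> l * (\<psi> k - \<psi> (k + 1)) + (l + 2 / B) * (\<psi> (k + 1) - \<psi> (N + 1)) + 2 / B * (\<psi> (N + 1) - \<psi> (k + 1))"
    using 1 2 3 4 by linarith
  also have "\<dots> = l * (\<psi> k - \<psi> (N + 1))"
    by (simp add: algebra_simps)
  finally show ?case
    by (simp add: l_def m_def k_def)
qed

end

section \<open>Convergence rate\<close>

theorem theorem3:
  fixes f :: "real ^ 'd \<Rightarrow> real" and g F :: "real ^ 'd \<Rightarrow> ereal"
    and L :: real and F_star :: ereal and N :: nat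
    and y :: "nat \<Rightarrow> real ^ 'd" and yp :: "int \<Rightarrow> real ^ 'd"
  assumes "0 < L"
    and "L_smooth_convex L f"
    and "closed_convex_proper g"
    and "F = (\<lambda>x. ereal (f x) + g x)"
    and "F_star = (INF x. F x)"
    and "F_star > -\<infinity>"
    and "N \<ge> 1"
    and "yp (-1) = y 0"
    and "\<And>k. k \<le> N \<Longrightarrow> yp (int k) = prox_grad_step f g L 4 (y k)"
    and "\<And>k. k + 2 \<le> N \<Longrightarrow>
      y (k + 1) = yp (int k)
        + (((real N - real k + 1) * (2 * real N - 2 * real k - 1))
            / ((real N - real k + 3) * (2 * real N - 2 * real k + 1)))
          *\<^sub>R (yp (int k) - yp (int k - 1))
        + (((4 * real N - 4 * real k - 1) * (2 * real N - 2 * real k - 1))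
            / (6 * (real N - real k + 3) * (2 * real N - 2 * real k + 1)))
          *\<^sub>R (yp (int k) - y k)"
    and "y N = yp (int N - 1)
        + (3 / 10) *\<^sub>R (yp (int N - 1) - yp (int N - 2))
        + (3 / 40) *\<^sub>R (yp (int N - 1) - y (N - 1))"
  shows "(\<exists>v. is_arg_min (\<lambda>v. (norm v)\<^sup>2) (\<lambda>v. v \<in> subdifferential F (yp (int N))) v
             \<and> (norm v)\<^sup>2 \<le> 25 * L\<^sup>2 * (norm (y N - yp (int N)))\<^sup>2)
       \<and> ereal (25 * L\<^sup>2 * (norm (y N - yp (int N)))\<^sup>2)
           \<le> ereal (50 * L / ((real N + 2) * (real N + 3))) * (F (y 0) - F_star)"
proof -
  note L = assms(1) and f = assms(2) and g = assms(3) and F = assms(4) and F_star = assms(5)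
    and step = assms(9)
  obtain x0 where "g x0 \<noteq> \<infinity>"
    using g by (auto simp: closed_convex_proper_def)
  moreover have F_star_le: "F_star \<le> F x" for x
    unfolding F_star by (rule INF_lower) simp
  ultimately have "F_star \<noteq> \<infinity>"
    using F_star_le[of x0] unfolding F by auto
  then obtain c where c: "F_star = ereal c"
    using assms(6) by (cases F_star) auto
  interpret composite_problem f g L 4 c
    using L f g F_star_le unfolding c F by unfold_locales auto
  \<comment> \<open>The shift makes natural indices start at \<open>yp (-1)\<close>.\<close>
  define q where "q k = yp (int k - 1)" for k
  have q_Suc: "q (k + 1) = prox_grad_step f g L 4 (y k)" if "k \<le> N" for k
    using step[OF that] by (simp add: q_def)
  interpret super_fista_sequence N y q
  proof
    show "q 0 = y 0"
      using assms(8) by (simp add: q_def)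
    show "y N = q N + (3 / 10) *\<^sub>R (q N - q (N - 1)) + (3 / 40) *\<^sub>R (q N - y (N - 1))"
      using assms(7,11) by (simp add: q_def of_nat_diff)
  qed (use assms(10) in \<open>simp add: q_def\<close>)
  have d: "d k = y k - prox_grad_step f g L 4 (y k)" if "k \<le> N" for k
    using q_Suc[OF that] by (simp add: d_def)
  have dN: "y N - yp (int N) = d N"
    by (simp add: d_def q_def)
  have ypN: "yp (int N) = prox_grad_step f g L 4 (y N)"
    by (rule step) simp
  have ineq: "F_at (y k) / L + (4 * (d k \<bullet> (z - y k)) + 7 / 2 * (norm (d k))\<^sup>2) \<le> r / L"
    if "k \<le> N" "F z = ereal r" for k z r
  proof -
    have "F_at (y k) + L * (4 * (d k \<bullet> (z - y k)) + 7 / 2 * (norm (d k))\<^sup>2) \<le> r"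
      using prox_grad_inequality[of "y k" z] that by (simp add: d F)
    then have "(F_at (y k) + L * (4 * (d k \<bullet> (z - y k)) + 7 / 2 * (norm (d k))\<^sup>2)) / L \<le> r / L"
      using L by (intro divide_right_mono) auto
    then show ?thesis
      using L by (simp add: add_divide_distrib)
  qed
  have F_q: "F (q (k + 1)) = ereal (F_at (y k))" if "k \<le> N" for k
    unfolding q_Suc[OF that] F by (rule F_step)

  have "\<exists>v. is_arg_min (\<lambda>v. (norm v)\<^sup>2) (\<lambda>v. v \<in> subdifferential F (yp (int N))) v
      \<and> (norm v)\<^sup>2 \<le> 25 * L\<^sup>2 * (norm (y N - yp (int N)))\<^sup>2"
  proof -
    define G where "G = gradient f (yp (int N)) - gradient f (y N) + (4 * L) *\<^sub>R (y N - yp (int N))"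
    have G: "G \<in> subdifferential F (yp (int N))" "norm G \<le> 5 * L * norm (y N - yp (int N))"
      using subgradient_F[of "y N"] unfolding G_def F ypN by simp_all
    have "closed (subdifferential F (yp (int N)))"
      using F_q[of N] by (intro closed_subdifferential[where a = "F_at (y N)"]) (simp add: q_def)
    then obtain v where v: "is_arg_min (\<lambda>v. (norm v)\<^sup>2) (\<lambda>v. v \<in> subdifferential F (yp (int N))) v"
      using closed_ex_min_norm G(1) by blast
    then have "(norm v)\<^sup>2 \<le> (norm G)\<^sup>2"
      using G(1) by (auto simp: is_arg_min_def not_less)
    also have "\<dots> \<le> (5 * L * norm (y N - yp (int N)))\<^sup>2"
      using G(2) by (intro power_mono) auto
    finally show ?thesis
      using v by (auto simp: power_mult_distrib)
  qed
  moreover have "ereal (25 * L\<^sup>2 * (norm (y N - yp (int N)))\<^sup>2)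
      \<le> ereal (50 * L / ((real N + 2) * (real N + 3))) * (F (y 0) - F_star)"
  proof (cases "F (y 0)")
    case (real F0)
    \<comment> \<open>\<open>\<psi> k\<close> is \<open>F (q k)\<close> over \<open>L\<close>; the
      shift arises because \<open>F_at\<close> is indexed by the point before the step.\<close>
    define \<psi> where "\<psi> k = (case k of 0 \<Rightarrow> F0 | Suc j \<Rightarrow> F_at (y j)) / L" for k
    have F_q': "F (q k) = ereal (\<psi> k * L)" if "k \<le> N + 1" for k
      using that L F_q[of "k - 1"] real start by (cases k) (simp_all add: \<psi>_def)
    have Z0: "Z (N - N) = 0" and \<psi>_ends: "\<psi> (N - N) = F0 / L" "\<psi> (N + 1) = F_at (y N) / L"
      by (simp_all add: Z_def \<psi>_def)
    have "(norm (d N))\<^sup>2 / 2 + potential_coeff N * (norm (cross N))\<^sup>2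
        + Z (N - N) \<bullet> (8 *\<^sub>R tail N - 4 *\<^sub>R cross N)
      \<le> (\<psi> (N - N) - \<psi> (N + 1)) / ((real N + 2) * (real N + 3))"
    proof (rule potential_bound)
      fix k assume "k \<le> N"
      then show "4 * (d k \<bullet> (q k - y k)) + 7 / 2 * (norm (d k))\<^sup>2 \<le> \<psi> k - \<psi> (k + 1)"
        using ineq[of k "q k", OF _ F_q'] L by (simp add: \<psi>_def)
    next
      fix k assume "k < N"
      then show "4 * (d k \<bullet> (q (N + 1) - y k)) + 7 / 2 * (norm (d k))\<^sup>2 \<le> \<psi> (N + 1) - \<psi> (k + 1)"
        using ineq[of k "q (N + 1)", OF _ F_q'] L by (simp add: \<psi>_def)
    qed simp
    moreover have "0 \<le> potential_coeff N * (norm (cross N))\<^sup>2"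
      by (simp add: potential_coeff_def)
    ultimately have "(norm (d N))\<^sup>2 / 2 \<le> (F0 / L - F_at (y N) / L) / ((real N + 2) * (real N + 3))"
      unfolding Z0 \<psi>_ends inner_zero_left by linarith
    also have "c \<le> F_at (y N)"
      using F_star_le[of "q (N + 1)"] F_q[of N] by (simp add: c)
    then have "(F0 / L - F_at (y N) / L) / ((real N + 2) * (real N + 3))
        \<le> (F0 - c) / L / ((real N + 2) * (real N + 3))"
      using L by (intro divide_right_mono) (simp_all add: diff_divide_distrib divide_right_mono)
    \<comment> \<open>The factor turns half the squared norm into the required
      \<open>25 * L\<^sup>2\<close> multiple.\<close>
    finally have "50 * L\<^sup>2 * ((norm (d N))\<^sup>2 / 2)
        \<le> 50 * L\<^sup>2 * ((F0 - c) / L / ((real N + 2) * (real N + 3)))"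
      by (intro mult_left_mono) auto
    also have "\<dots> = 50 * L / ((real N + 2) * (real N + 3)) * (F0 - c)"
      using L by (simp add: power2_eq_square)
    finally show ?thesis
      unfolding dN real c by simp
  next
    case PInf
    \<comment> \<open>Strict positivity matters, as \<open>0 * \<infinity> = 0\<close> in
      \<open>ereal\<close>.\<close>
    have "0 < 50 * L / ((real N + 2) * (real N + 3))"
      using L by simp
    then show ?thesis
      by (simp add: PInf c)
  next
    case MInf
    then show ?thesis
      using F_star_le[of "y 0"] by (simp add: c)
  qed
  ultimately show ?thesis ..
qed

end
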